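(* Let $F$ be any one of the faces $(\hat U_{2,5}^{1},U_{1,1}^{1})$, $(\hat U_{2,5}^{1},U_{1,1}^{2})$, $(\hat U_{2,5}^{1},U_{1,2}^{12})$ of $\Gamma_4$. For real $a,b\ge 0$, the point $\mathbf h=(a,b)\in F$ is entropic if and only if $a=\log v$ for some integer $v\ge 1$.
   Context: $N_4=\{1,2,3,4\}$. $\Gamma_4$ is the cone of all polymatroid rank functions on $N_4$. A set function $\mathbf h:2^{N_4}\to\mathbb R$ is called entropic if there is a random vector $(X_1,X_2,X_3,X_4)$, each $X_i$ taking values in a finite set, with $\mathbf h(A)=H(X_A)$ for all $A\subseteq N_4$, where $H$ is Shannon entropy, $X_A=(X_j,j\in A)$ and $\mathbf h(\emptyset)=0$. Logarithms (also in the entropy) are to base $2$. For two (poly)matroids $M_1,M_2$ on $N_4$ with rank functions $\mathbf r_1,\mathbf r_2$, $(M_1,M_2)$ denotes the face $\{a\mathbf r_1+b\mathbf r_2:a,b\ge0\}$ of $\Gamma_4$, and $(a,b)$ denotes the point $a\mathbf r_1+b\mathbf r_2$. For $\alpha\subseteq N_4$ with $|\alpha|=m$, $U^\alpha_{k,m}$ is the matroid on $N_4$ with rank function $\mathbf r(A)=\min\{k,|A\cap\alpha|\}$. $\hat U^1_{2,5}$ is the integer polymatroid on $N_4$ with rank function $\mathbf r(A)=\min\{2,|A|\}$ for $A\neq\{1\}$ and $\mathbf r(\{1\})=2$. Superscripts such as $12$ abbreviate $\{1,2\}$. *)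

theory Defs
  imports "HOL-Probability.Probability"
begin

definition N4 :: "nat set" where
  "N4 = {1, 2, 3, 4}"

text \<open>
  Set functions on the power set of \<open>N4\<close> are represented by functions on all sets of natural
  numbers; their values outside the power set of \<open>N4\<close> never matter.
\<close>

subsection \<open>Polymatroids and their rank functions\<close>

definition Gamma4 :: "(nat set \<Rightarrow> real) set" where
  "Gamma4 = {h. h {} = 0 \<and>
     (\<forall>A B. A \<subseteq> B \<longrightarrow> B \<subseteq> N4 \<longrightarrow> h A \<le> h B) \<and>
     (\<forall>A B. A \<subseteq> N4 \<longrightarrow> B \<subseteq> N4 \<longrightarrow> h (A \<union> B) + h (A \<inter> B) \<le> h A + h B)}"

text \<open>The matroid \<open>U\<^sup>\<alpha>\<^sub>k\<^sub>,\<^sub>m\<close> with \<open>m = card \<alpha>\<close>.\<close>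

definition uniform_rank :: "nat \<Rightarrow> nat set \<Rightarrow> nat set \<Rightarrow> real" where
  "uniform_rank k \<alpha> A = real (min k (card (A \<inter> \<alpha>)))"

text \<open>The integer polymatroid written \<open>U\<^sup>1\<^sub>2\<^sub>,\<^sub>5\<close> with a hat.\<close>

definition Uhat25_1 :: "nat set \<Rightarrow> real" where
  "Uhat25_1 A = (if A = {1} then 2 else real (min 2 (card A)))"

text \<open>
  The point written \<open>(a, b)\<close> of the face \<open>(M\<^sub>1, M\<^sub>2)\<close>, where \<open>r1\<close>, \<open>r2\<close> are the rank functions of
  \<open>M\<^sub>1\<close>, \<open>M\<^sub>2\<close>. For \<open>a, b \<ge> 0\<close> these points form the face; see \<open>face_point_in_Gamma4\<close>.
\<close>

definition face_point ::
    "(nat set \<Rightarrow> real) \<Rightarrow> (nat set \<Rightarrow> real) \<Rightarrow> real \<Rightarrow> real \<Rightarrow> nat set \<Rightarrow> real" where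
  "face_point r1 r2 a b = (\<lambda>A. a * r1 A + b * r2 A)"

lemma Gamma4_capped_card:
  assumes h: "\<And>A. A \<subseteq> N4 \<Longrightarrow> h A = real (min k (\<Sum>i\<in>A. w i))"
  shows "h \<in> Gamma4"
  unfolding Gamma4_def
proof (safe)
  show "h {} = 0"
    by (simp add: h)
next
  fix A B assume A: "A \<subseteq> B" and B: "B \<subseteq> N4"
  have "finite B"
    using B by (rule finite_subset) (simp add: N4_def)
  then have "(\<Sum>i\<in>A. w i) \<le> (\<Sum>i\<in>B. w i)"
    using A by (intro sum_mono2) auto
  then show "h A \<le> h B"
    using A B by (simp add: h)
next
  fix A B assume A: "A \<subseteq> N4" and B: "B \<subseteq> N4"
  have fin: "finite A" "finite B"
    using A B finite_subset[of _ N4] by (auto simp: N4_def)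
  then have "(\<Sum>i\<in>A \<union> B. w i) + (\<Sum>i\<in>A \<inter> B. w i) = (\<Sum>i\<in>A. w i) + (\<Sum>i\<in>B. w i)"
    by (rule sum.union_inter)
  moreover have "(\<Sum>i\<in>A \<inter> B. w i) \<le> (\<Sum>i\<in>A. w i)" "(\<Sum>i\<in>A \<inter> B. w i) \<le> (\<Sum>i\<in>B. w i)"
    using fin by (auto intro!: sum_mono2)
  moreover have "h (A \<union> B) = real (min k (\<Sum>i\<in>A \<union> B. w i))" "h (A \<inter> B) = real (min k (\<Sum>i\<in>A \<inter> B. w i))"
    using A B by (auto intro: h)
  ultimately show "h (A \<union> B) + h (A \<inter> B) \<le> h A + h B"
    unfolding h[OF A] h[OF B] by linarith
qed

lemma uniform_rank_in_Gamma4: "uniform_rank k \<alpha> \<in> Gamma4"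
proof (rule Gamma4_capped_card)
  fix A assume "A \<subseteq> N4"
  then have "finite A"
    by (rule finite_subset) (simp add: N4_def)
  then have "card (A \<inter> \<alpha>) = (\<Sum>i\<in>A. if i \<in> \<alpha> then 1 else 0)"
    by (simp add: sum.If_cases)
  then show "uniform_rank k \<alpha> A = real (min k (\<Sum>i\<in>A. if i \<in> \<alpha> then 1 else 0))"
    by (simp add: uniform_rank_def)
qed

lemma Uhat25_1_in_Gamma4: "Uhat25_1 \<in> Gamma4"
proof (rule Gamma4_capped_card)
  fix A assume "A \<subseteq> N4"
  then have fin: "finite A"
    by (rule finite_subset) (simp add: N4_def)
  show "Uhat25_1 A = real (min 2 (\<Sum>i\<in>A. if i = 1 then 2 else 1))"
  proof (cases "1 \<in> A")
    case True
    have "A = insert 1 (A - {1})"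
      using True by blast
    then have sum: "(\<Sum>i\<in>A. if i = 1 then 2 else 1 :: nat) = 2 + card (A - {1})"
      using sum.remove[OF fin True, of "\<lambda>i. if i = 1 then 2 else 1 :: nat"] by simp
    have "2 \<le> card A" if "A \<noteq> {1}"
    proof -
      have "A - {1} \<noteq> {}"
        using that True by blast
      then have "0 < card (A - {1})"
        using fin by (simp add: card_gt_0_iff)
      then show ?thesis
        using True fin by simp
    qed
    then show ?thesis
      unfolding Uhat25_1_def sum by auto
  next
    case False
    then have "(\<Sum>i\<in>A. if i = 1 then 2 else 1 :: nat) = (\<Sum>i\<in>A. 1)"
      by (intro sum.cong) auto
    then show ?thesis
      using False by (auto simp: Uhat25_1_def)
  qed
qed

lemma face_point_in_Gamma4:
  assumes "r1 \<in> Gamma4" "r2 \<in> Gamma4" "0 \<le> a" "0 \<le> b"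
  shows "face_point r1 r2 a b \<in> Gamma4"
  unfolding Gamma4_def
proof safe
  show "face_point r1 r2 a b {} = 0"
    using assms by (simp add: Gamma4_def face_point_def)
next
  fix A B assume "A \<subseteq> B" "B \<subseteq> N4"
  then show "face_point r1 r2 a b A \<le> face_point r1 r2 a b B"
    using assms by (auto simp: Gamma4_def face_point_def intro!: add_mono mult_left_mono)
next
  fix A B assume "A \<subseteq> N4" "B \<subseteq> N4"
  then have "a * (r1 (A \<union> B) + r1 (A \<inter> B)) \<le> a * (r1 A + r1 B)"
    and "b * (r2 (A \<union> B) + r2 (A \<inter> B)) \<le> b * (r2 A + r2 B)"
    using assms by (auto simp: Gamma4_def intro!: mult_left_mono)
  then show "face_point r1 r2 a b (A \<union> B) + face_point r1 r2 a b (A \<inter> B)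
      \<le> face_point r1 r2 a b A + face_point r1 r2 a b B"
    by (simp add: face_point_def algebra_simps)
qed

subsection \<open>Entropic set functions\<close>

definition subvector :: "(nat \<Rightarrow> 'w \<Rightarrow> 'v) \<Rightarrow> nat set \<Rightarrow> 'w \<Rightarrow> nat \<Rightarrow> 'v" where
  "subvector X A \<omega> = (\<lambda>i\<in>A. X i \<omega>)"

definition joint_entropy :: "'w measure \<Rightarrow> (nat \<Rightarrow> 'w \<Rightarrow> 'v) \<Rightarrow> nat set \<Rightarrow> real" where
  "joint_entropy M X A =
     prob_space.entropy M 2 (count_space (subvector X A ` space M)) (subvector X A)"

definition entropy_representation ::
    "'w measure \<Rightarrow> (nat \<Rightarrow> 'w \<Rightarrow> 'v) \<Rightarrow> (nat set \<Rightarrow> real) \<Rightarrow> bool" where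
  "entropy_representation M X h \<longleftrightarrow>
     prob_space M \<and> (\<forall>i\<in>N4. simple_function M (X i)) \<and>
     (\<forall>A\<subseteq>N4. h A = joint_entropy M X A)"

text \<open>
  A definition cannot quantify over types, so sample space and values are taken in \<open>nat\<close>.
  Lemma \<open>entropic_if_representation\<close> below shows that this is no restriction.
\<close>

definition entropic :: "(nat set \<Rightarrow> real) \<Rightarrow> bool" where
  "entropic h \<longleftrightarrow>
     (\<exists>(M :: nat measure) (X :: nat \<Rightarrow> nat \<Rightarrow> nat). entropy_representation M X h)"

lemma simple_function_subvector:
  assumes "finite A" and "\<And>i. i \<in> A \<Longrightarrow> simple_function M (X i)"
  shows "simple_function M (subvector X A)"
  unfolding simple_function_def
proof safe
  have "subvector X A ` space M \<subseteq> PiE A (\<lambda>i. X i ` space M)"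
    by (auto simp: subvector_def)
  moreover have "finite (PiE A (\<lambda>i. X i ` space M))"
    using assms by (intro finite_PiE) (auto simp: simple_function_def)
  ultimately show "finite (subvector X A ` space M)"
    by (rule finite_subset)
next
  fix \<omega> assume w: "\<omega> \<in> space M"
  have "subvector X A -` {subvector X A \<omega>} \<inter> space M
      = {x \<in> space M. \<forall>i\<in>A. X i x = X i \<omega>}"
    by (auto simp: subvector_def restrict_def fun_eq_iff split: if_splits)
  also have "\<dots> \<in> sets M"
  proof (rule sets.sets_Collect_finite_All[OF _ assms(1)])
    fix i assume "i \<in> A"
    then have "X i -` {X i \<omega>} \<inter> space M \<in> sets M"
      using assms(2) w by (auto simp: simple_function_def)
    also have "X i -` {X i \<omega>} \<inter> space M = {x \<in> space M. X i x = X i \<omega>}"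
      by auto
    finally show "{x \<in> space M. X i x = X i \<omega>} \<in> sets M" .
  qed
  finally show "subvector X A -` {subvector X A \<omega>} \<inter> space M \<in> sets M" .
qed

lemma entropy_as_sum:
  assumes M: "prob_space M" and R: "simple_function M R"
  shows "prob_space.entropy M 2 (count_space (R ` space M)) R
       = - (\<Sum>x\<in>R ` space M. measure M {y \<in> space M. R y = x}
              * log 2 (measure M {y \<in> space M. R y = x}))"
proof -
  interpret information_space M 2
    using M by (simp add: information_space_def information_space_axioms_def)
  show ?thesis
  proof (rule entropy_simple_distributed, rule simple_distributedI[OF R])
    fix x
    have "R -` {x} \<inter> space M = {y \<in> space M. R y = x}"
      by blast
    then show "prob {y \<in> space M. R y = x} = prob (R -` {x} \<inter> space M)"
      by simp
  qed simp
qed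

lemma entropy_injective_image:
  assumes M: "prob_space M" and Z: "simple_function M Z"
    and inj: "inj_on f (Z ` space M)" and W: "\<And>\<omega>. \<omega> \<in> space M \<Longrightarrow> W \<omega> = f (Z \<omega>)"
  shows "prob_space.entropy M 2 (count_space (W ` space M)) W
       = prob_space.entropy M 2 (count_space (Z ` space M)) Z"
proof -
  interpret information_space M 2
    using M by (simp add: information_space_def information_space_axioms_def)
  have "simple_function M (f \<circ> Z)"
    using Z by (rule simple_function_compose)
  then have sW: "simple_function M W"
    by (subst simple_function_cong[where g = "f \<circ> Z"]) (simp_all add: W)
  have im: "W ` space M = f ` (Z ` space M)"
    using W by (auto simp: image_iff)
  have eq: "{x \<in> space M. W x = f z} = {x \<in> space M. Z x = z}" if "z \<in> Z ` space M" for z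
    using that W inj_on_eq_iff[OF inj] by auto
  show ?thesis
    unfolding entropy_as_sum[OF M sW] entropy_as_sum[OF M Z]
    unfolding im sum.reindex[OF inj] by (simp add: eq)
qed

lemma entropy_distr_image:
  assumes M: "prob_space M" and T: "simple_function M T"
  defines "M' \<equiv> distr M (count_space (T ` space M)) T"
  shows "prob_space.entropy M' 2 (count_space (Z ` space M')) Z
       = prob_space.entropy M 2 (count_space ((Z \<circ> T) ` space M)) (Z \<circ> T)"
proof -
  have meas: "T \<in> M \<rightarrow>\<^sub>M count_space (T ` space M)"
    using T by (auto simp: measurable_count_space_eq2 simple_function_def)
  then have M': "prob_space M'"
    unfolding M'_def by (rule prob_space.prob_space_distr[OF M])
  have im: "Z ` space M' = (Z \<circ> T) ` space M"
    by (auto simp: M'_def)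
  have "distr M' (count_space (Z ` space M')) Z = distr M (count_space (Z ` space M')) (Z \<circ> T)"
    unfolding M'_def by (rule distr_distr[OF _ meas]) auto
  then show ?thesis
    by (simp add: prob_space.entropy_def[OF M] prob_space.entropy_def[OF M'] im)
qed

lemma entropic_if_representation:
  fixes M :: "'w measure" and X :: "nat \<Rightarrow> 'w \<Rightarrow> 'v"
  assumes rep: "entropy_representation M X h"
  shows "entropic h"
proof -
  have M: "prob_space M" and X: "\<And>i. i \<in> N4 \<Longrightarrow> simple_function M (X i)"
    and h: "\<And>A. A \<subseteq> N4 \<Longrightarrow> h A = joint_entropy M X A"
    using rep by (auto simp: entropy_representation_def)
  have fin: "finite A" if "A \<subseteq> N4" for A
    using that by (rule finite_subset) (simp add: N4_def)
  define Y where "Y = subvector X N4"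
  have Y: "simple_function M Y"
    unfolding Y_def using fin X by (intro simple_function_subvector) auto
  have finS: "finite (Y ` space M)"
    using Y by (simp add: simple_function_def)
  then obtain g :: "(nat \<Rightarrow> 'v) \<Rightarrow> nat" where g: "inj_on g (Y ` space M)"
    using finite_imp_inj_to_nat_seg[OF finS] by auto
  define V where "V = (\<Union>i\<in>N4. X i ` space M)"
  have "finite V"
    using X fin by (auto simp: V_def simple_function_def)
  then obtain c :: "'v \<Rightarrow> nat" where c: "inj_on c V"
    using finite_imp_inj_to_nat_seg[OF \<open>finite V\<close>] by auto
  define T where "T = g \<circ> Y"
  have T: "simple_function M T"
    unfolding T_def by (rule simple_function_compose[OF Y])
  define M' where "M' = distr M (count_space (T ` space M)) T"
  define X' where "X' = (\<lambda>i n. c (inv_into (Y ` space M) g n i))"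
  have X'T: "X' i (T \<omega>) = c (X i \<omega>)" if "\<omega> \<in> space M" "i \<in> N4" for i \<omega>
    using that g by (simp add: X'_def T_def) (simp add: Y_def subvector_def)
  have meas: "T \<in> M \<rightarrow>\<^sub>M count_space (T ` space M)"
    using T by (auto simp: measurable_count_space_eq2 simple_function_def)
  have "prob_space M'"
    unfolding M'_def by (rule prob_space.prob_space_distr[OF M meas])
  moreover have "simple_function M' (X' i)" for i
    using T by (auto simp: M'_def simple_function_def)
  moreover have "h A = joint_entropy M' X' A" if A: "A \<subseteq> N4" for A
  proof -
    have "joint_entropy M' X' A
        = prob_space.entropy M 2 (count_space ((subvector X' A \<circ> T) ` space M)) (subvector X' A \<circ> T)"
      unfolding joint_entropy_def M'_def by (rule entropy_distr_image[OF M T])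
    also have "\<dots> = joint_entropy M X A"
      unfolding joint_entropy_def
    proof (rule entropy_injective_image[OF M, where f = "\<lambda>v. \<lambda>i\<in>A. c (v i)"])
      show "simple_function M (subvector X A)"
        using A X fin by (intro simple_function_subvector) auto
      show "inj_on (\<lambda>v. \<lambda>i\<in>A. c (v i)) (subvector X A ` space M)"
      proof (safe intro!: inj_onI)
        fix \<omega> \<omega>' assume w: "\<omega> \<in> space M" "\<omega>' \<in> space M"
          and eq: "(\<lambda>i\<in>A. c (subvector X A \<omega> i)) = (\<lambda>i\<in>A. c (subvector X A \<omega>' i))"
        have "X i \<omega> = X i \<omega>'" if "i \<in> A" for i
        proof (rule inj_onD[OF c])
          show "c (X i \<omega>) = c (X i \<omega>')"
            using fun_cong[OF eq, of i] that by (simp add: subvector_def)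
        qed (use w A that in \<open>auto simp: V_def\<close>)
        then show "subvector X A \<omega> = subvector X A \<omega>'"
          by (auto simp: subvector_def restrict_def)
      qed
      show "(subvector X' A \<circ> T) \<omega> = (\<lambda>i\<in>A. c (subvector X A \<omega> i))" if "\<omega> \<in> space M" for \<omega>
        using that A X'T by (auto simp: subvector_def restrict_def fun_eq_iff)
    qed
    finally show ?thesis
      using h[OF A] by simp
  qed
  ultimately show ?thesis
    unfolding entropic_def entropy_representation_def by blast
qed

end

theory Submission
  imports Defs "HOL-Real_Asymp.Real_Asymp"
begin

text \<open>
  If \<open>(a, b)\<close> is entropic, then \<open>X\<^sub>2\<close>, \<open>X\<^sub>3\<close>, \<open>X\<^sub>4\<close> are pairwise independent, and each of
  \<open>X\<^sub>3\<close>, \<open>X\<^sub>4\<close> is determined by the other together with \<open>X\<^sub>2\<close>. This forces \<open>X\<^sub>3\<close> to be uniform on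
  its support, so that its entropy \<open>a\<close> is the logarithm of an integer. Conversely, let \<open>s\<close>, \<open>t\<close> be
  uniform modulo \<open>v\<close> and \<open>w\<close> of entropy \<open>b\<close>, all independent; the vector with entries \<open>(s, t)\<close>,
  \<open>s + t\<close>, \<open>s\<close>, \<open>t\<close>, where \<open>w\<close> is appended to the entries in \<open>\<beta>\<close>, realizes the point
  \<open>(log v, b)\<close> of the face of \<open>U\<^sup>1\<^sub>2\<^sub>,\<^sub>5\<close> with a hat and \<open>U\<^sup>\<beta>\<^sub>1\<^sub>,\<^sub>m\<close>, where \<open>m\<close> is the size of \<open>\<beta>\<close>.
\<close>

section \<open>Equality cases of entropy inequalities\<close>

text \<open>Put \<open>d = q - p + p * (ln p - ln q)\<close>. Each term is nonnegative by
  \<open>ln z \<le> z - 1\<close> at \<open>z = q / p\<close>, while the hypotheses make the sum at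
  most 0. Hence all terms vanish, and \<open>ln z = z - 1\<close> only at \<open>z = 1\<close>;
  where \<open>p\<close> is 0, \<open>d\<close> equals \<open>q\<close>.\<close>

lemma gibbs_equality:
  fixes p q :: "'a \<Rightarrow> real"
  assumes fin: "finite S" and p: "\<And>x. x \<in> S \<Longrightarrow> 0 \<le> p x" and q: "\<And>x. x \<in> S \<Longrightarrow> 0 \<le> q x"
    and pq: "\<And>x. x \<in> S \<Longrightarrow> 0 < p x \<Longrightarrow> 0 < q x"
    and sums: "sum q S \<le> sum p S"
    and eq: "(\<Sum>x\<in>S. p x * (log 2 (p x) - log 2 (q x))) = 0"
    and x: "x \<in> S"
  shows "p x = q x"
proof -
  define d where "d y = q y - p y + p y * (ln (p y) - ln (q y))" for y
  have ratio: "p y * (ln (p y) - ln (q y)) = - p y * ln (q y / p y)" if "y \<in> S" "0 < p y" for y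
    using pq[OF that] that by (simp add: ln_div algebra_simps)
  have d_nonneg: "0 \<le> d y" if y: "y \<in> S" for y
  proof (cases "p y = 0")
    case True
    then show ?thesis
      using q[OF y] by (simp add: d_def)
  next
    case False
    then have pos: "0 < p y" "0 < q y"
      using p[OF y] pq[OF y] by auto
    then have "p y * ln (q y / p y) \<le> p y * (q y / p y - 1)"
      by (intro mult_left_mono ln_le_minus_one) auto
    then show ?thesis
      using pos ratio[OF y] by (simp add: d_def algebra_simps)
  qed
  have "(\<Sum>y\<in>S. p y * (ln (p y) - ln (q y))) = ln 2 * (\<Sum>y\<in>S. p y * (log 2 (p y) - log 2 (q y)))"
    by (simp add: sum_distrib_left log_def diff_divide_distrib[symmetric])
  then have "sum d S \<le> 0"
    using sums eq by (simp add: d_def sum.distrib sum_subtractf)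
  then have "sum d S = 0"
    using d_nonneg by (intro antisym sum_nonneg) auto
  then have dx: "d x = 0"
    using sum_nonneg_eq_0_iff[OF fin, of d] d_nonneg x by auto
  show ?thesis
  proof (cases "p x = 0")
    case True
    then show ?thesis
      using dx by (simp add: d_def)
  next
    case False
    then have pos: "0 < p x" "0 < q x"
      using p[OF x] pq[OF x] x by auto
    have "p x * ln (q x / p x) = p x * (q x / p x - 1)"
      using dx ratio[OF x] pos by (simp add: d_def algebra_simps)
    then have "ln (q x / p x) = q x / p x - 1"
      using pos by simp
    then have "q x / p x = 1"
      using pos by (intro ln_eq_minus_one) auto
    then show ?thesis
      using pos by simp
  qed
qed

section \<open>Joint laws and entropies of finite-valued random variables\<close>

context prob_space
begin

abbreviation law :: "('a \<Rightarrow> 'b) \<Rightarrow> 'b \<Rightarrow> real" where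
  "law R x \<equiv> prob {\<omega> \<in> space M. R \<omega> = x}"

definition simple_entropy :: "('a \<Rightarrow> 'b) \<Rightarrow> real" where
  "simple_entropy R = - (\<Sum>x\<in>R ` space M. law R x * log 2 (law R x))"

lemma simple_entropy_eq:
  "simple_function M R \<Longrightarrow> entropy 2 (count_space (R ` space M)) R = simple_entropy R"
  unfolding simple_entropy_def by (rule entropy_as_sum) unfold_locales

lemma law_sets:
  assumes "simple_function M R"
  shows "{\<omega> \<in> space M. R \<omega> = x} \<in> events"
proof -
  have "R -` {x} \<inter> space M \<in> events"
    using assms by (rule simple_functionD)
  also have "R -` {x} \<inter> space M = {\<omega> \<in> space M. R \<omega> = x}"
    by auto
  finally show ?thesis .
qed

lemma law_marginal:
  assumes U: "simple_function M U" and V: "simple_function M V"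
  shows "law U u = (\<Sum>v\<in>V ` space M. law (\<lambda>\<omega>. (U \<omega>, V \<omega>)) (u, v))"
proof -
  have UV: "simple_function M (\<lambda>\<omega>. (U \<omega>, V \<omega>))"
    using U V by (rule simple_function_Pair)
  have "law U u = prob (\<Union>v\<in>V ` space M. {\<omega> \<in> space M. (U \<omega>, V \<omega>) = (u, v)})"
    by (rule arg_cong[where f = prob]) auto
  also have "\<dots> = (\<Sum>v\<in>V ` space M. law (\<lambda>\<omega>. (U \<omega>, V \<omega>)) (u, v))"
    using V law_sets[OF UV]
    by (intro finite_measure_finite_Union)
       (auto simp: disjoint_family_on_def simple_function_def simp del: prod.inject)
  finally show ?thesis .
qed

lemma law_swap: "law (\<lambda>\<omega>. (V \<omega>, U \<omega>)) (v, u) = law (\<lambda>\<omega>. (U \<omega>, V \<omega>)) (u, v)"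
  by (rule arg_cong[where f = prob]) auto

lemma law_sum_eq_1:
  assumes "simple_function M U"
  shows "(\<Sum>u\<in>U ` space M. law U u) = 1"
proof -
  have "(\<Sum>u\<in>U ` space M. law U u) = prob (\<Union>u\<in>U ` space M. {\<omega> \<in> space M. U \<omega> = u})"
    using assms law_sets[OF assms]
    by (intro finite_measure_finite_Union[symmetric])
       (auto simp: disjoint_family_on_def simple_function_def)
  also have "(\<Union>u\<in>U ` space M. {\<omega> \<in> space M. U \<omega> = u}) = space M"
    by auto
  finally show ?thesis
    by (simp add: prob_space)
qed

lemma law_pair_le:
  assumes "simple_function M U"
  shows "law (\<lambda>\<omega>. (U \<omega>, V \<omega>)) (u, v) \<le> law U u"
  using law_sets[OF assms] by (intro finite_measure_mono) auto

text \<open>The sum over the range of the pair extends to the full rectangle because pairs that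
  never occur have probability 0.\<close>

lemma simple_entropy_pair:
  assumes U: "simple_function M U" and V: "simple_function M V"
  shows "simple_entropy (\<lambda>\<omega>. (U \<omega>, V \<omega>)) =
    - (\<Sum>(u, v)\<in>U ` space M \<times> V ` space M.
        law (\<lambda>\<omega>. (U \<omega>, V \<omega>)) (u, v) * log 2 (law (\<lambda>\<omega>. (U \<omega>, V \<omega>)) (u, v)))"
  unfolding simple_entropy_def neg_equal_iff_equal case_prod_eta
proof (rule sum.mono_neutral_cong_left)
  show "finite (U ` space M \<times> V ` space M)"
    using U V by (simp add: simple_function_def)
  have "law (\<lambda>\<omega>. (U \<omega>, V \<omega>)) x = 0" if "x \<notin> (\<lambda>\<omega>. (U \<omega>, V \<omega>)) ` space M" for x
  proof -
    have empty: "{\<omega> \<in> space M. (U \<omega>, V \<omega>) = x} = {}"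
      using that by auto
    show ?thesis
      unfolding empty by simp
  qed
  then show "\<forall>x\<in>U ` space M \<times> V ` space M - (\<lambda>\<omega>. (U \<omega>, V \<omega>)) ` space M.
      (case x of (u, v) \<Rightarrow> law (\<lambda>\<omega>. (U \<omega>, V \<omega>)) (u, v) * log 2 (law (\<lambda>\<omega>. (U \<omega>, V \<omega>)) (u, v))) = 0"
    by (auto simp del: prod.inject)
qed auto

text \<open>Expanding one factor \<open>law U u\<close> as a sum of joint probabilities puts the
  marginal entropy on the same rectangle, with the same weights, as the joint entropy, so that the
  two can be compared term by term.\<close>

lemma simple_entropy_marginal:
  assumes U: "simple_function M U" and V: "simple_function M V"
  shows "simple_entropy U =
    - (\<Sum>(u, v)\<in>U ` space M \<times> V ` space M. law (\<lambda>\<omega>. (U \<omega>, V \<omega>)) (u, v) * log 2 (law U u))"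
  unfolding simple_entropy_def sum.cartesian_product[symmetric] sum_distrib_right[symmetric]
  by (simp only: law_marginal[OF U V, symmetric])

text \<open>The sum of the marginal entropies minus the joint entropy is the divergence of the joint
  law from the product of the marginals, and \<open>gibbs_equality\<close> applies to its
  vanishing.\<close>

lemma simple_entropy_additive_imp_indep:
  assumes U: "simple_function M U" and V: "simple_function M V"
    and eq: "simple_entropy (\<lambda>\<omega>. (U \<omega>, V \<omega>)) = simple_entropy U + simple_entropy V"
    and u: "u \<in> U ` space M" and v: "v \<in> V ` space M"
  shows "law (\<lambda>\<omega>. (U \<omega>, V \<omega>)) (u, v) = law U u * law V v"
proof -
  let ?S = "U ` space M \<times> V ` space M"
  define p where "p x = law (\<lambda>\<omega>. (U \<omega>, V \<omega>)) x" for x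
  define q where "q x = law U (fst x) * law V (snd x)" for x
  have V_entropy: "simple_entropy V = - (\<Sum>(u, v)\<in>?S. p (u, v) * log 2 (law V v))"
    unfolding simple_entropy_marginal[OF V U] law_swap[of V U] p_def sum.cartesian_product[symmetric]
    by (subst sum.swap) (rule refl)
  have le: "p (u, v) \<le> law U u" "p (u, v) \<le> law V v" for u v
    unfolding p_def by (rule law_pair_le[OF U], subst law_swap, rule law_pair_le[OF V])
  have pos: "0 < law U (fst x)" "0 < law V (snd x)" if "0 < p x" for x
    using le[of "fst x" "snd x"] that unfolding prod.collapse by linarith+
  have "p (u, v) = q (u, v)"
  proof (rule gibbs_equality[of ?S])
    show "finite ?S"
      using U V by (simp add: simple_function_def)
    show "0 < q x" if "0 < p x" for x
      unfolding q_def using pos[OF that] by (rule mult_pos_pos)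
    have "sum q ?S = 1"
      using law_sum_eq_1[OF U] law_sum_eq_1[OF V]
      by (simp add: q_def sum.cartesian_product' sum_distrib_left[symmetric])
    moreover have "sum p ?S = 1"
      using law_sum_eq_1[OF U] unfolding law_marginal[OF U V] p_def sum.cartesian_product' .
    ultimately show "sum q ?S \<le> sum p ?S"
      by simp
    \<comment> \<open>Where \<open>p x\<close> is positive, so are both marginals, and the logarithm
      of their product splits; where \<open>p x = 0\<close>, both sides are 0.\<close>
    have "p x * (log 2 (p x) - log 2 (q x))
        = p x * log 2 (p x) - p x * log 2 (law U (fst x)) - p x * log 2 (law V (snd x))" for x
    proof (cases "p x = 0")
      case False
      then have "0 < p x"
        by (simp add: p_def zero_less_measure_iff)
      then have "log 2 (q x) = log 2 (law U (fst x)) + log 2 (law V (snd x))"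
        unfolding q_def by (intro log_mult_pos pos)
      then show ?thesis
        by (simp only: ring_distribs)
    qed simp
    then show "(\<Sum>x\<in>?S. p x * (log 2 (p x) - log 2 (q x))) = 0"
      using eq unfolding V_entropy simple_entropy_marginal[OF U V] simple_entropy_pair[OF U V] p_def[symmetric]
      by (simp add: sum_subtractf case_prod_unfold)
  qed (use u v in \<open>auto simp: p_def q_def\<close>)
  then show ?thesis
    by (simp add: p_def q_def)
qed

text \<open>The conditional entropy of \<open>V\<close> given \<open>U\<close> is the sum of the
  terms \<open>p * (log (law U) - log p)\<close>, each nonnegative because \<open>p\<close> is at
  most \<open>law U\<close>. If the sum is 0 then every term is, and a term with
  \<open>p > 0\<close> forces equality.\<close>

lemma simple_entropy_eq_imp_determined:
  assumes U: "simple_function M U" and V: "simple_function M V"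
    and eq: "simple_entropy (\<lambda>\<omega>. (U \<omega>, V \<omega>)) = simple_entropy U"
    and u: "u \<in> U ` space M" and v: "v \<in> V ` space M"
    and pos: "0 < law (\<lambda>\<omega>. (U \<omega>, V \<omega>)) (u, v)"
  shows "law (\<lambda>\<omega>. (U \<omega>, V \<omega>)) (u, v) = law U u"
proof -
  let ?S = "U ` space M \<times> V ` space M"
  define p where "p x = law (\<lambda>\<omega>. (U \<omega>, V \<omega>)) x" for x
  have le: "p (u, v) \<le> law U u" for u v
    unfolding p_def using U by (rule law_pair_le)
  define d where "d x = p x * (log 2 (law U (fst x)) - log 2 (p x))" for x
  have nonneg: "0 \<le> d x" for x
  proof (cases "p x = 0")
    case False
    then have "0 < p x"
      by (simp add: p_def zero_less_measure_iff)
    then show ?thesis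
      using le[of "fst x" "snd x"] by (simp add: d_def)
  qed (simp add: d_def)
  have "sum d ?S = 0"
    using eq unfolding simple_entropy_marginal[OF U V] simple_entropy_pair[OF U V] p_def[symmetric]
    by (simp add: sum_subtractf case_prod_unfold d_def right_diff_distrib)
  moreover have "finite ?S"
    using U V by (simp add: simple_function_def)
  ultimately have "d (u, v) = 0"
    using sum_nonneg_eq_0_iff[of ?S d] nonneg u v by auto
  moreover have "0 < p (u, v)" "0 < law U u"
    using pos le[of u v] by (simp_all add: p_def)
  ultimately have "law U u = p (u, v)"
    by (simp add: d_def log_def)
  then show ?thesis
    by (simp add: p_def)
qed

lemma simple_entropy_inj:
  assumes "simple_function M Z" and "inj_on f (Z ` space M)"
    and "\<And>\<omega>. \<omega> \<in> space M \<Longrightarrow> W \<omega> = f (Z \<omega>)"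
  shows "entropy 2 (count_space (W ` space M)) W = simple_entropy Z"
  using entropy_injective_image[OF prob_space_axioms assms] simple_entropy_eq[OF assms(1)] by simp

text \<open>
  A value \<open>x\<close> of \<open>Z\<close> compatible with \<open>U = u\<close> and \<open>V = v\<close> gives
  \<open>P(Z = x) P(U = u) = P(Z = x, U = u, V = v) = P(Z = x) P(V = v)\<close>, and such an \<open>x\<close> exists for all
  possible \<open>u\<close> and \<open>v\<close> since \<open>U\<close> and \<open>V\<close> are independent.
\<close>

lemma latin_square_entropy:
  assumes Z: "simple_function M Z" and U: "simple_function M U" and V: "simple_function M V"
    and ZU: "simple_entropy (\<lambda>\<omega>. (Z \<omega>, U \<omega>)) = simple_entropy Z + simple_entropy U"
    and ZV: "simple_entropy (\<lambda>\<omega>. (Z \<omega>, V \<omega>)) = simple_entropy Z + simple_entropy V"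
    and UV: "simple_entropy (\<lambda>\<omega>. (U \<omega>, V \<omega>)) = simple_entropy U + simple_entropy V"
    and ZUV: "simple_entropy (\<lambda>\<omega>. ((Z \<omega>, U \<omega>), V \<omega>)) = simple_entropy (\<lambda>\<omega>. (Z \<omega>, U \<omega>))"
    and ZVU: "simple_entropy (\<lambda>\<omega>. ((Z \<omega>, V \<omega>), U \<omega>)) = simple_entropy (\<lambda>\<omega>. (Z \<omega>, V \<omega>))"
  obtains k :: nat where "1 \<le> k" "simple_entropy U = log 2 (real k)"
proof -
  have sZU: "simple_function M (\<lambda>\<omega>. (Z \<omega>, U \<omega>))" and sZV: "simple_function M (\<lambda>\<omega>. (Z \<omega>, V \<omega>))"
    and sUV: "simple_function M (\<lambda>\<omega>. (U \<omega>, V \<omega>))"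
    using Z U V by (auto intro: simple_function_Pair)
  have eq: "law U u = law V v"
    if u: "u \<in> U ` space M" "0 < law U u" and v: "v \<in> V ` space M" "0 < law V v" for u v
  proof -
    have "0 < law (\<lambda>\<omega>. (U \<omega>, V \<omega>)) (u, v)"
      using simple_entropy_additive_imp_indep[OF U V UV u(1) v(1)] u v by simp
    then have "0 < (\<Sum>x\<in>Z ` space M. law (\<lambda>\<omega>. ((U \<omega>, V \<omega>), Z \<omega>)) ((u, v), x))"
      using law_marginal[OF sUV Z, of "(u, v)"] by simp
    then obtain x where x: "x \<in> Z ` space M" "law (\<lambda>\<omega>. ((U \<omega>, V \<omega>), Z \<omega>)) ((u, v), x) \<noteq> 0"
      by (metis (no_types, lifting) less_irrefl sum.neutral)
    define P where "P = prob {\<omega> \<in> space M. Z \<omega> = x \<and> U \<omega> = u \<and> V \<omega> = v}"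
    have P: "law (\<lambda>\<omega>. ((U \<omega>, V \<omega>), Z \<omega>)) ((u, v), x) = P" "law (\<lambda>\<omega>. ((Z \<omega>, U \<omega>), V \<omega>)) ((x, u), v) = P"
      "law (\<lambda>\<omega>. ((Z \<omega>, V \<omega>), U \<omega>)) ((x, v), u) = P"
      unfolding P_def by (auto intro!: arg_cong[where f = prob])
    have pos: "0 < P"
      using x(2) unfolding P(1) by (simp add: P_def zero_less_measure_iff)
    then have "{\<omega> \<in> space M. Z \<omega> = x \<and> U \<omega> = u \<and> V \<omega> = v} \<noteq> {}"
      unfolding P_def by (metis less_irrefl measure_empty)
    then have xu: "(x, u) \<in> (\<lambda>\<omega>. (Z \<omega>, U \<omega>)) ` space M" and xv: "(x, v) \<in> (\<lambda>\<omega>. (Z \<omega>, V \<omega>)) ` space M"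
      by auto
    have "P = law Z x * law U u"
      using simple_entropy_eq_imp_determined[OF sZU V ZUV xu v(1)] pos
        simple_entropy_additive_imp_indep[OF Z U ZU x(1) u(1)] by (simp only: P)
    moreover have "P = law Z x * law V v"
      using simple_entropy_eq_imp_determined[OF sZV U ZVU xv u(1)] pos
        simple_entropy_additive_imp_indep[OF Z V ZV x(1) v(1)] by (simp only: P)
    ultimately show ?thesis
      using pos by auto
  qed
  have "\<exists>v\<in>V ` space M. law V v \<noteq> 0"
    using law_sum_eq_1[OF V] by (metis (no_types, lifting) sum.neutral zero_neq_one)
  then obtain v where v: "v \<in> V ` space M" "0 < law V v"
    by (auto simp: zero_less_measure_iff)
  \<comment> \<open>Every possible \<open>u\<close> is compared with this one \<open>v\<close>, so
    the law of \<open>U\<close> is constant, equal to \<open>c\<close>, on its support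
    \<open>K\<close>.\<close>
  define c where "c = law V v"
  define K where "K = {u \<in> U ` space M. 0 < law U u}"
  have fin: "finite (U ` space M)"
    using U by (simp add: simple_function_def)
  have c: "law U u = c" if "u \<in> K" for u
    using eq that v by (auto simp: K_def c_def)
  have outside: "\<forall>u\<in>U ` space M - K. law U u = 0"
    by (auto simp: K_def zero_less_measure_iff)
  have K: "K \<subseteq> U ` space M"
    unfolding K_def by (rule Collect_restrict)
  have "(\<Sum>u\<in>U ` space M. law U u) = (\<Sum>u\<in>K. c)"
    using fin K outside c by (rule sum.mono_neutral_cong_right)
  then have one: "real (card K) * c = 1"
    using law_sum_eq_1[OF U] by simp
  have "simple_entropy U = - (\<Sum>u\<in>K. c * log 2 c)"
    unfolding simple_entropy_def neg_equal_iff_equal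
  proof (rule sum.mono_neutral_cong_right[OF fin K])
    show "\<forall>u\<in>U ` space M - K. law U u * log 2 (law U u) = 0"
      using outside by simp
  qed (simp only: c)
  also have "\<dots> = - log 2 c"
    using one by simp
  also have "c = 1 / real (card K)"
    using one by (cases "card K = 0") (auto simp: field_simps)
  finally have "simple_entropy U = log 2 (real (card K))"
    using one by (cases "card K = 0") (auto simp: log_divide)
  moreover have "1 \<le> card K"
    using one by (cases "card K = 0") auto
  ultimately show ?thesis
    using that by blast
qed

end

section \<open>From identities of the set function to random variables\<close>

text \<open>The identities become the hypotheses of \<open>latin_square_entropy\<close> with
  \<open>X 2\<close>, \<open>X 3\<close>, \<open>X 4\<close> in the roles of \<open>Z\<close>,
  \<open>U\<close>, \<open>V\<close>.\<close>

lemma entropic_latin_square: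
  assumes "entropic h"
    and "h {2, 3} = h {2} + h {3}" "h {2, 4} = h {2} + h {4}" "h {3, 4} = h {3} + h {4}"
    and "h {2, 3, 4} = h {2, 3}" "h {2, 3, 4} = h {2, 4}"
  shows "\<exists>v::nat. v \<ge> 1 \<and> h {3} = log 2 (real v)"
proof -
  obtain M :: "nat measure" and X :: "nat \<Rightarrow> nat \<Rightarrow> nat" where rep: "entropy_representation M X h"
    using assms(1) unfolding entropic_def by blast
  interpret prob_space M
    using rep by (simp add: entropy_representation_def)
  have X: "simple_function M (X 2)" "simple_function M (X 3)" "simple_function M (X 4)"
    using rep by (auto simp: entropy_representation_def N4_def)
  have h: "h A = simple_entropy Z"
    if "A \<subseteq> N4" "simple_function M Z" "inj f" "\<And>\<omega>. subvector X A \<omega> = f (Z \<omega>)"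
    for A and Z :: "nat \<Rightarrow> 'z" and f
    using rep that simple_entropy_inj[of Z f "subvector X A"]
    by (auto simp: entropy_representation_def joint_entropy_def inj_on_def)
  note pair = simple_function_Pair
  have h1: "h {i} = simple_entropy (X i)" if "i \<in> N4" "simple_function M (X i)" for i
    using that by (intro h[of _ _ "\<lambda>x. \<lambda>j\<in>{i}. x"]) (auto simp: subvector_def inj_def fun_eq_iff)
  have h2: "h {i, j} = simple_entropy (\<lambda>\<omega>. (X i \<omega>, X j \<omega>))"
    if "i \<in> N4" "j \<in> N4" "i \<noteq> j" "simple_function M (X i)" "simple_function M (X j)" for i j
    using that by (intro h[of _ _ "\<lambda>x. \<lambda>k\<in>{i, j}. if k = i then fst x else snd x"])
      (auto simp: subvector_def inj_def fun_eq_iff restrict_def intro: pair split: if_splits)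
  have h3: "h {i, j, k} = simple_entropy (\<lambda>\<omega>. ((X i \<omega>, X j \<omega>), X k \<omega>))"
    if "i \<in> N4" "j \<in> N4" "k \<in> N4" "i \<noteq> j" "i \<noteq> k" "j \<noteq> k"
      "simple_function M (X i)" "simple_function M (X j)" "simple_function M (X k)" for i j k
    using that by (intro h[of _ _ "\<lambda>x. \<lambda>l\<in>{i, j, k}.
        if l = i then fst (fst x) else if l = j then snd (fst x) else snd x"])
      (auto simp: subvector_def inj_def fun_eq_iff restrict_def intro: pair split: if_splits)
  have N4: "2 \<in> N4" "3 \<in> N4" "4 \<in> N4"
    by (auto simp: N4_def)
  have swap: "{2, 4, 3} = {2, 3, 4 :: nat}"
    by auto
  \<comment> \<open>The triple is bracketed in two ways, once for each pair that determines the
    third entry.\<close>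
  have e: "h {2} = simple_entropy (X 2)" "h {3} = simple_entropy (X 3)" "h {4} = simple_entropy (X 4)"
    "h {2, 3} = simple_entropy (\<lambda>\<omega>. (X 2 \<omega>, X 3 \<omega>))"
    "h {2, 4} = simple_entropy (\<lambda>\<omega>. (X 2 \<omega>, X 4 \<omega>))"
    "h {3, 4} = simple_entropy (\<lambda>\<omega>. (X 3 \<omega>, X 4 \<omega>))"
    "h {2, 3, 4} = simple_entropy (\<lambda>\<omega>. ((X 2 \<omega>, X 3 \<omega>), X 4 \<omega>))"
    "h {2, 3, 4} = simple_entropy (\<lambda>\<omega>. ((X 2 \<omega>, X 4 \<omega>), X 3 \<omega>))"
    using N4 X h1 h2 h3 h3[of 2 4 3] by (simp_all add: swap)
  obtain k :: nat where "1 \<le> k" "simple_entropy (X 3) = log 2 (real k)"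
    by (rule latin_square_entropy[OF X assms(2-4)[unfolded e(1-6)]
          assms(5)[unfolded e(4,7)] assms(6)[unfolded e(5,8)]])
  then show ?thesis
    unfolding e(2) by blast
qed

section \<open>Realizations\<close>

text \<open>Grouping outcomes by the value of \<open>R\<close> writes the entropy as the mean of
  \<open>- log\<close> of the probability of the class of an outcome, so that it can be evaluated
  outcome by outcome.\<close>

lemma entropy_point_measure:
  fixes p :: "'w \<Rightarrow> real"
  assumes fin: "finite \<Omega>" and p: "\<And>\<omega>. \<omega> \<in> \<Omega> \<Longrightarrow> 0 \<le> p \<omega>" and sum: "sum p \<Omega> = 1"
  defines "M \<equiv> point_measure \<Omega> (\<lambda>\<omega>. ennreal (p \<omega>))"
  shows "prob_space M"
    and "simple_function M R"
    and "prob_space.entropy M 2 (count_space (R ` space M)) R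
      = - (\<Sum>\<omega>\<in>\<Omega>. p \<omega> * log 2 (\<Sum>\<omega>' | \<omega>' \<in> \<Omega> \<and> R \<omega>' = R \<omega>. p \<omega>'))"
proof -
  have space: "space M = \<Omega>"
    by (simp add: M_def space_point_measure)
  show prob: "prob_space M"
  proof
    show "emeasure M (space M) = 1"
      using fin p sum by (simp add: M_def space_point_measure emeasure_point_measure_finite sum_ennreal)
  qed
  show simple: "simple_function M R"
    using fin by (simp add: M_def simple_function_def space_point_measure sets_point_measure)
  have measure: "measure M A = sum p A" if "A \<subseteq> \<Omega>" for A
    unfolding M_def using fin p that by (simp add: measure_point_measure_finite_if)
  have "(\<Sum>\<omega>\<in>\<Omega>. p \<omega> * log 2 (\<Sum>\<omega>' | \<omega>' \<in> \<Omega> \<and> R \<omega>' = R \<omega>. p \<omega>'))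
      = (\<Sum>x\<in>R ` \<Omega>. \<Sum>\<omega> | \<omega> \<in> \<Omega> \<and> R \<omega> = x.
          p \<omega> * log 2 (\<Sum>\<omega>' | \<omega>' \<in> \<Omega> \<and> R \<omega>' = R \<omega>. p \<omega>'))"
    using fin by (rule sum.image_gen)
  also have "\<dots> = (\<Sum>x\<in>R ` \<Omega>. (\<Sum>\<omega> | \<omega> \<in> \<Omega> \<and> R \<omega> = x. p \<omega>) * log 2 (\<Sum>\<omega> | \<omega> \<in> \<Omega> \<and> R \<omega> = x. p \<omega>))"
    by (simp add: sum_distrib_right)
  finally show "prob_space.entropy M 2 (count_space (R ` space M)) R
      = - (\<Sum>\<omega>\<in>\<Omega>. p \<omega> * log 2 (\<Sum>\<omega>' | \<omega>' \<in> \<Omega> \<and> R \<omega>' = R \<omega>. p \<omega>'))"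
    unfolding entropy_as_sum[OF prob simple] by (simp add: space measure)
qed

section \<open>Distributions of prescribed entropy\<close>

text \<open>Mass \<open>1 - x\<close> at one point and mass \<open>x\<close> spread evenly over
  \<open>k\<close> others have entropy 0 at \<open>x = 0\<close> and \<open>log k\<close> at
  \<open>x = 1\<close>; for \<open>k > 2 powr b\<close> the intermediate value theorem supplies an
  \<open>x\<close> with entropy \<open>b\<close>.\<close>

lemma exists_distribution_with_entropy:
  fixes b :: real
  assumes "0 \<le> b"
  obtains n :: nat and q :: "nat \<Rightarrow> real"
  where "\<And>i. 0 \<le> q i" "(\<Sum>i<n. q i) = 1" "b = - (\<Sum>i<n. q i * log 2 (q i))"
proof -
  obtain k :: nat where k: "2 powr b < real k"
    using reals_Archimedean2 by blast
  then have k0: "0 < k"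
    by (metis less_asym of_nat_0_less_iff powr_gt_zero less_trans zero_less_numeral)
  have bk: "b \<le> log 2 k"
    using k k0 by (simp add: le_log_iff)
  define f :: "real \<Rightarrow> real" where
    "f x = - ((1 - x) * log 2 (1 - x)) - x * log 2 x + x * log 2 k" for x
  \<comment> \<open>At the endpoint 0 the logarithm is discontinuous, yet \<open>x * ln x\<close>
    tends to 0, the value of \<open>0 * ln 0\<close>.\<close>
  have xln: "continuous_on {0..1} (\<lambda>x::real. x * ln x)"
  proof (rule continuous_on_IccI)
    show "((\<lambda>x::real. x * ln x) \<longlongrightarrow> 0 * ln 0) (at_right 0)"
      by simp real_asymp
  qed (auto intro!: tendsto_eq_intros)
  then have g: "continuous_on {0..1} (\<lambda>x::real. x * log 2 x)"
    unfolding log_def times_divide_eq_right by (intro continuous_on_divide continuous_on_const) auto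
  have "continuous_on {0..1} (\<lambda>x::real. (1 - x) * log 2 (1 - x))"
    by (rule continuous_on_compose2[OF g, of _ "\<lambda>x. 1 - x"]) (auto intro!: continuous_intros)
  then have "continuous_on {0..1} f"
    unfolding f_def by (intro continuous_on_add continuous_on_diff continuous_on_minus continuous_on_mult_right continuous_on_id g)
  moreover have "f 0 \<le> b" "b \<le> f 1"
    using assms bk by (auto simp: f_def)
  ultimately obtain x where x: "0 \<le> x" "x \<le> 1" "f x = b"
    using IVT'[of f 0 b 1] by auto
  define q where "q i = (if i = 0 then 1 - x else x / k)" for i :: nat
  show ?thesis
  proof (rule that[of q "Suc k"])
    show "0 \<le> q i" for i
      using x by (simp add: q_def)
    show "(\<Sum>i<Suc k. q i) = 1"
      unfolding sum.lessThan_Suc_shift using k0 by (simp add: q_def)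
    have "x * log 2 (x / k) = x * log 2 x - x * log 2 k"
      using x k0 by (cases "x = 0") (auto simp: log_divide algebra_simps)
    then show "b = - (\<Sum>i<Suc k. q i * log 2 (q i))"
      unfolding sum.lessThan_Suc_shift using k0 x(3) by (simp add: q_def f_def)
  qed
qed

section \<open>The Latin square modulo \<open>v\<close>\<close>

text \<open>The second components \<open>0\<close> only pad the coordinates to a common type.\<close>

definition latin_coordinate :: "nat \<Rightarrow> nat \<Rightarrow> nat \<times> nat \<Rightarrow> nat \<times> nat" where
  "latin_coordinate v i = (\<lambda>(s, t).
     if i = 1 then (s, t) else if i = 2 then ((s + t) mod v, 0) else if i = 3 then (s, 0) else (t, 0))"

lemma mod_add_left_cancel:
  fixes s t u v :: nat
  assumes "t < v" "u < v" "(s + t) mod v = (s + u) mod v"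
  shows "t = u"
proof -
  have "int v dvd int (s + t) - int (s + u)"
    using assms(3) by (metis mod_eq_dvd_iff of_nat_mod)
  then have "int v dvd int t - int u"
    by simp
  then show ?thesis
    using assms(1,2) by (metis mod_eq_dvd_iff mod_less of_nat_eq_iff of_nat_mod)
qed

text \<open>Fibres have \<open>v ^ (2 - k)\<close> points for \<open>k\<close> the rank of
  \<open>A\<close>; the product form avoids the subtraction. The empty set leaves both
  \<open>s\<close> and \<open>t\<close> free, a single one of 2, 3, 4 leaves one degree of freedom,
  and coordinate 1 or any two of 2, 3, 4 determine \<open>(s, t)\<close>.\<close>

lemma card_latin_fibre:
  assumes A: "A \<subseteq> N4" and s: "s < v" and t: "t < v"
  obtains k where "Uhat25_1 A = real k"
    "card {y \<in> {..<v} \<times> {..<v}. \<forall>i\<in>A. latin_coordinate v i y = latin_coordinate v i (s, t)} * v ^ k = v ^ 2"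
proof -
  let ?F = "{y \<in> {..<v} \<times> {..<v}. \<forall>i\<in>A. latin_coordinate v i y = latin_coordinate v i (s, t)}"
  have Uhat: "Uhat25_1 A = 2" if "{i, j} \<subseteq> A" "i \<noteq> j" for i j
  proof -
    have "finite A"
      using A by (rule finite_subset) (simp add: N4_def)
    then have "2 \<le> card A"
      using card_mono[of A "{i, j}"] that by simp
    then show ?thesis
      by (auto simp: Uhat25_1_def)
  qed
  \<comment> \<open>The choice \<open>i = j\<close> is permitted, since coordinate 1 alone recovers
    \<open>(s, t)\<close>.\<close>
  have singleton: "?F = {(s, t)}"
    if ij: "{i, j} \<subseteq> A"
      and inj: "\<And>s' t'. s' < v \<Longrightarrow> t' < v \<Longrightarrow> latin_coordinate v i (s', t') = latin_coordinate v i (s, t)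
        \<Longrightarrow> latin_coordinate v j (s', t') = latin_coordinate v j (s, t) \<Longrightarrow> (s', t') = (s, t)" for i j
  proof
    show "?F \<subseteq> {(s, t)}"
    proof
      fix y assume y: "y \<in> ?F"
      then have "y = (s, t)"
        using inj[of "fst y" "snd y"] ij by auto
      then show "y \<in> {(s, t)}"
        by simp
    qed
  qed (use s t in auto)
  consider "A = {}" | "A = {2}" | "A = {3}" | "A = {4}"
    | "1 \<in> A" | "{2, 3} \<subseteq> A" | "{2, 4} \<subseteq> A" | "{3, 4} \<subseteq> A"
    using A unfolding N4_def by blast
  then consider "A = {}" | "A = {2}" | "A = {3}" | "A = {4}" | "Uhat25_1 A = 2" "?F = {(s, t)}"
  proof cases
    case 5
    have "Uhat25_1 A = 2"
    proof (cases "A = {1}")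
      case False
      then obtain j where "{1, j} \<subseteq> A" "1 \<noteq> j"
        using 5 by blast
      then show ?thesis
        by (rule Uhat)
    qed (simp add: Uhat25_1_def)
    moreover have "?F = {(s, t)}"
      using 5 by (intro singleton[of 1 1]) (auto simp: latin_coordinate_def)
    ultimately show ?thesis
      by (rule that(5))
  next
    case 6
    have "?F = {(s, t)}"
    proof (rule singleton[OF 6])
      fix s' t'
      assume "s' < v" "t' < v"
        "latin_coordinate v 2 (s', t') = latin_coordinate v 2 (s, t)"
        "latin_coordinate v 3 (s', t') = latin_coordinate v 3 (s, t)"
      then show "(s', t') = (s, t)"
        using mod_add_left_cancel[of t' v t s] t by (simp add: latin_coordinate_def)
    qed
    with Uhat[OF 6] show ?thesis
      by (intro that(5)) auto
  next
    case 7
    have "?F = {(s, t)}"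
    proof (rule singleton[OF 7])
      fix s' t'
      assume "s' < v" "t' < v"
        "latin_coordinate v 2 (s', t') = latin_coordinate v 2 (s, t)"
        "latin_coordinate v 4 (s', t') = latin_coordinate v 4 (s, t)"
      then show "(s', t') = (s, t)"
        using mod_add_left_cancel[of s' v s t] s by (simp add: latin_coordinate_def add.commute)
    qed
    with Uhat[OF 7] show ?thesis
      by (intro that(5)) auto
  next
    case 8
    have "?F = {(s, t)}"
      by (rule singleton[OF 8]) (simp add: latin_coordinate_def)
    with Uhat[OF 8] show ?thesis
      by (intro that(5)) auto
  qed (rule that; assumption)+
  then show ?thesis
  proof cases
    case 1
    have "?F = {..<v} \<times> {..<v}"
      using 1 by auto
    then show ?thesis
      using 1 by (intro that[of 0]) (auto simp: Uhat25_1_def power2_eq_square)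
  next
    case 2
    \<comment> \<open>The witness is \<open>s + t - x\<close> modulo \<open>v\<close>; adding
      \<open>v - x\<close> replaces subtracting \<open>x\<close> in the natural numbers.\<close>
    have surj: "\<exists>y<v. (x + y) mod v = (s + t) mod v" if "x < v" for x
    proof (intro exI conjI)
      show "(s + t + (v - x)) mod v < v"
        using s by simp
      have "(x + (s + t + (v - x)) mod v) mod v = (s + t + v) mod v"
        using that by (simp add: mod_add_right_eq)
      then show "(x + (s + t + (v - x)) mod v) mod v = (s + t) mod v"
        by simp
    qed
    \<comment> \<open>For a fixed sum, the first summand is arbitrary and determines the
      second.\<close>
    have "bij_betw fst ?F {..<v}"
      unfolding bij_betw_def
    proof
      show "inj_on fst ?F"
        using 2 by (auto simp: inj_on_def latin_coordinate_def) (metis mod_add_left_cancel)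
      show "fst ` ?F = {..<v}"
        using 2 surj by (force simp: latin_coordinate_def image_iff)
    qed
    then have "card ?F = v"
      using bij_betw_same_card by fastforce
    then show ?thesis
      using 2 by (intro that[of 1]) (auto simp: Uhat25_1_def power2_eq_square)
  next
    case 3
    have "?F = {s} \<times> {..<v}"
      using 3 s by (auto simp: latin_coordinate_def)
    then show ?thesis
      using 3 by (intro that[of 1]) (auto simp: Uhat25_1_def power2_eq_square)
  next
    case 4
    have "?F = {..<v} \<times> {t}"
      using 4 t by (auto simp: latin_coordinate_def)
    then show ?thesis
      using 4 by (intro that[of 1]) (auto simp: Uhat25_1_def power2_eq_square)
  next
    case 5
    then show ?thesis
      by (intro that[of 2]) auto
  qed
qed

text \<open>The class of an outcome is a Latin fibre times all of \<open>{..<n}\<close> if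
  \<open>A\<close> misses \<open>\<beta>\<close>, and times the single value \<open>w\<close> if
  \<open>A\<close> meets it. Its probability is therefore \<open>1 / v ^ k\<close> times 1 or
  \<open>q w\<close>, and the entropy splits into \<open>k * log v\<close> plus 0 or
  \<open>b\<close>.\<close>

lemma entropic_Uhat25_face:
  assumes v: "1 \<le> v" and b: "0 \<le> b"
  shows "entropic (face_point Uhat25_1 (uniform_rank 1 \<beta>) (log 2 (real v)) b)"
proof -
  obtain n :: nat and q :: "nat \<Rightarrow> real" where q: "\<And>i. 0 \<le> q i" "(\<Sum>i<n. q i) = 1"
    and bq: "b = - (\<Sum>i<n. q i * log 2 (q i))"
    using exists_distribution_with_entropy[OF b] by blast
  define D where "D = {..<v} \<times> {..<v}"
  define \<Omega> where "\<Omega> = D \<times> {..<n}"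
  define p where "p \<omega> = q (snd \<omega>) / real v ^ 2" for \<omega> :: "(nat \<times> nat) \<times> nat"
  \<comment> \<open>The constant 0 makes entries outside \<open>\<beta>\<close> carry no information
    about \<open>w\<close>.\<close>
  define X where "X i \<omega> = (latin_coordinate v i (fst \<omega>), if i \<in> \<beta> then snd \<omega> else 0)"
    for i and \<omega> :: "(nat \<times> nat) \<times> nat"
  define M where "M = point_measure \<Omega> (\<lambda>\<omega>. ennreal (p \<omega>))"
  have finD: "finite D" and cardD: "card D = v ^ 2"
    by (auto simp: D_def power2_eq_square)
  have fin: "finite \<Omega>"
    using finD by (simp add: \<Omega>_def)
  have p: "0 \<le> p \<omega>" for \<omega>
    using q by (simp add: p_def)
  \<comment> \<open>The weight is a product, uniform on \<open>D\<close>; this one identity serves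
    the total mass, the class masses and the final entropy sum.\<close>
  have sum_p: "(\<Sum>\<omega>\<in>K \<times> C. p \<omega> * g (snd \<omega>)) = real (card K) / real v ^ 2 * (\<Sum>w\<in>C. q w * g w)" for K C g
    by (simp add: sum.cartesian_product' p_def sum_distrib_left sum_divide_distrib)
  have "sum p \<Omega> = 1"
    using sum_p[of "\<lambda>_. 1" D "{..<n}"] q v cardD by (simp add: \<Omega>_def)
  note point = entropy_point_measure[OF fin p this, folded M_def]
  have "entropy_representation M X (face_point Uhat25_1 (uniform_rank 1 \<beta>) (log 2 (real v)) b)"
    unfolding entropy_representation_def
  proof (intro conjI ballI allI impI)
    show "prob_space M" "simple_function M (X i)" for i
      by (rule point)+
    fix A assume A: "A \<subseteq> N4"
    then have finA: "finite A"
      by (rule finite_subset) (simp add: N4_def)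
    \<comment> \<open>This is the contribution of \<open>w\<close> to the log probability of the
      class; it is 0 when \<open>w\<close> is summed out.\<close>
    define g where "g w = (if A \<inter> \<beta> = {} then 0 else log 2 (q w))" for w
    have class_log: "p \<omega> * log 2 (\<Sum>\<omega>' | \<omega>' \<in> \<Omega> \<and> subvector X A \<omega>' = subvector X A \<omega>. p \<omega>')
        = p \<omega> * (g (snd \<omega>) - log 2 v * Uhat25_1 A)" if "\<omega> \<in> \<Omega>" for \<omega>
    proof -
      obtain s t w where \<omega>: "\<omega> = ((s, t), w)" "s < v" "t < v" "w < n"
        using \<open>\<omega> \<in> \<Omega>\<close> by (auto simp: \<Omega>_def D_def)
      define K where
        "K = {y \<in> D. \<forall>i\<in>A. latin_coordinate v i y = latin_coordinate v i (s, t)}"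
      obtain k where k: "Uhat25_1 A = real k" "card K * v ^ k = v ^ 2"
        using card_latin_fibre[OF A \<omega>(2,3)] unfolding K_def D_def .
      define C where "C = (if A \<inter> \<beta> = {} then {..<n} else {w})"
      have iff: "subvector X A \<omega>' = subvector X A \<omega> \<longleftrightarrow> (\<forall>i\<in>A. X i \<omega>' = X i \<omega>)" for \<omega>'
        by (auto simp: subvector_def restrict_def fun_eq_iff)
      have fibre: "{\<omega>'. \<omega>' \<in> \<Omega> \<and> subvector X A \<omega>' = subvector X A \<omega>} = K \<times> C"
        unfolding iff using \<omega> by (auto simp: X_def \<Omega>_def K_def C_def D_def)
      have "sum p (K \<times> C) = real (card K) / real v ^ 2 * sum q C"
        using sum_p[of "\<lambda>_. 1" K C] by simp
      also have "real (card K) / real v ^ 2 = 1 / real v ^ k"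
      proof -
        have "real (card K) * real v ^ k = real v ^ 2"
          using arg_cong[OF k(2), of real] by simp
        then show ?thesis
          using v by (simp add: field_simps)
      qed
      also have "sum q C = (if A \<inter> \<beta> = {} then 1 else q w)"
        using q by (simp add: C_def)
      finally have S: "sum p (K \<times> C) = (if A \<inter> \<beta> = {} then 1 else q w) / real v ^ k"
        by simp
      \<comment> \<open>Outcomes with \<open>q w = 0\<close> have weight 0, so the logarithm of a
        zero probability does no harm.\<close>
      show ?thesis
      proof (cases "q w = 0")
        case True
        then show ?thesis
          by (simp add: p_def \<omega>)
      next
        case False
        then have "0 < q w"
          using q(1)[of w] by simp
        then show ?thesis
          unfolding fibre S k(1) using v \<omega> by (auto simp: g_def log_divide log_nat_power)
      qed
    qed
    have "joint_entropy M X A = - (\<Sum>\<omega>\<in>\<Omega>. p \<omega> * (g (snd \<omega>) - log 2 v * Uhat25_1 A))"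
      unfolding joint_entropy_def point(3) neg_equal_iff_equal
      by (rule sum.cong[OF refl]) (rule class_log)
    also have "\<dots> = - (\<Sum>w<n. q w * (g w - log 2 v * Uhat25_1 A))"
      unfolding \<Omega>_def by (subst sum_p) (use v cardD in simp)
    also have "\<dots> = log 2 v * Uhat25_1 A * (\<Sum>w<n. q w) + - (\<Sum>w<n. q w * g w)"
      unfolding right_diff_distrib sum_subtractf sum_distrib_right[symmetric] by (simp add: mult_ac)
    also have "- (\<Sum>w<n. q w * g w) = b * uniform_rank 1 \<beta> A"
    proof (cases "A \<inter> \<beta> = {}")
      case False
      then have "0 < card (A \<inter> \<beta>)"
        using finA by (simp add: card_gt_0_iff)
      then show ?thesis
        using False by (simp add: g_def bq uniform_rank_def min_def)
    qed (simp add: g_def uniform_rank_def)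
    finally show "face_point Uhat25_1 (uniform_rank 1 \<beta>) (log 2 (real v)) b A = joint_entropy M X A"
      using q by (simp add: face_point_def)
  qed
  then show ?thesis
    by (rule entropic_if_representation)
qed

section \<open>The entropic points of the three faces\<close>

theorem mainTheorem6:
  fixes r1 r2 :: "nat set \<Rightarrow> real" and a b :: real
  assumes "(r1, r2) \<in>
    {(Uhat25_1, uniform_rank 1 {1}), (Uhat25_1, uniform_rank 1 {2}), (Uhat25_1, uniform_rank 1 {1, 2})}"
    and "a \<ge> 0" and "b \<ge> 0"
  shows "entropic (face_point r1 r2 a b) \<longleftrightarrow> (\<exists>v::nat. v \<ge> 1 \<and> a = log 2 (real v))"
proof
  assume h: "entropic (face_point r1 r2 a b)"
  \<comment> \<open>The index 3 lies outside the index set of each \<open>r2\<close>, so no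
    \<open>b\<close> appears.\<close>
  have "face_point r1 r2 a b {3} = a"
    using assms(1) by (auto simp: face_point_def Uhat25_1_def uniform_rank_def)
  \<comment> \<open>Among 2, 3, 4 only 2 can contribute \<open>b\<close>, and each required identity
    has it equally often on both sides.\<close>
  moreover have "\<exists>v::nat. v \<ge> 1 \<and> face_point r1 r2 a b {3} = log 2 (real v)"
    using assms(1) by (intro entropic_latin_square[OF h])
      (auto simp: face_point_def Uhat25_1_def uniform_rank_def insert_eq_iff)
  ultimately show "\<exists>v::nat. v \<ge> 1 \<and> a = log 2 (real v)"
    by simp
next
  assume "\<exists>v::nat. v \<ge> 1 \<and> a = log 2 (real v)"
  then show "entropic (face_point r1 r2 a b)"
    using assms entropic_Uhat25_face by blast
qed

end
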